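(* Suppose that the parameters $a,b\in\mathbb{R}$ are fixed with $ab<0$, and let $$c:=\frac{\pi b}{b-a},\qquad \mu_1:=\frac{c}{\sin(c)},\qquad \mu_2:=\frac{1}{\cos(c/2)}.$$ Let $M(x,\mu)=\int_0^{2\pi}f(x-\mu\cos t)\,dt$ for $(x,\mu)\in\mathbb{R}^2$. Then there exists a unique function $\varphi:[0,1-b/a]\to(0,+\infty)$ such that the zero set of $M$ can be written in the form $$M^{-1}(\{0\})=\{(0,\mu)\in\mathbb{R}^2:\mu\in\mathbb{R}\}\cup Z_1\cup S_1(Z_1)\cup S_2(Z_1)\cup S_2(S_1(Z_1)),$$ where $S_1$ and $S_2$ are the symmetries $S_1(x,\mu):=(-x,\mu)$ and $S_2(x,\mu):=(x,-\mu)$, and $$Z_1=\{(1-b/a,\mu)\in\mathbb{R}^2:0\le\mu\le -b/a\}\cup\{(x,\mu)\in\mathbb{R}^2:\mu=\varphi(x),\ 0<x<1-b/a\}.$$ Moreover, $\varphi$ satisfies the following properties: (1) $\varphi$ is differentiable in $(0,1-b/a)$. (2) $\varphi$ possesses a unique critical point $x_1\in(0,1-b/a)$. Furthermore, $\varphi'(x)>0$ for $x\in(0,x_1)$, $\varphi'(x)<0$ for $x\in(x_1,1-b/a)$, and $x_1$ is given by $x_1:=1-\mu_1\cos(c)$. (3) $\varphi$ is continuous in $[0,1-b/a]$, $\varphi(1-b/a)=-b/a$ and $\varphi(0)=\mu_2$.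
   Context: For $a,b\in\mathbb{R}$, the function $f:\mathbb{R}\to\mathbb{R}$ is the continuous odd piecewise linear function $$f(x)=\begin{cases} ax+(a-b), & x\le -1,\\ bx, & -1<x<1,\\ ax+(b-a), & x\ge 1.\end{cases}$$ Since $ab<0$, one has $1-b/a>1$ and $c\in(0,\pi)$.
   Formalization: The zero-set formula does not involve φ(0) or φ(1-b/a), so uniqueness of φ on the closed interval fails as stated; here φ is shown unique on (0,1-b/a), and unique on [0,1-b/a] among continuous functions. *)

theory Defs
  imports "HOL-Analysis.Analysis"
begin

definition pwl :: "real \<Rightarrow> real \<Rightarrow> real \<Rightarrow> real" where
  "pwl a b x =
     (if x \<le> -1 then a * x + (a - b)
      else if x < 1 then b * x
      else a * x + (b - a))"

definition M :: "real \<Rightarrow> real \<Rightarrow> real \<times> real \<Rightarrow> real" where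
  "M a b = (\<lambda>(x, \<mu>). integral {0..2 * pi} (\<lambda>t. pwl a b (x - \<mu> * cos t)))"

definition S1 :: "real \<times> real \<Rightarrow> real \<times> real" where
  "S1 = (\<lambda>(x, \<mu>). (- x, \<mu>))"

definition S2 :: "real \<times> real \<Rightarrow> real \<times> real" where
  "S2 = (\<lambda>(x, \<mu>). (x, - \<mu>))"

definition Z1 :: "real \<Rightarrow> real \<Rightarrow> (real \<Rightarrow> real) \<Rightarrow> (real \<times> real) set" where
  "Z1 a b \<phi> =
     {(1 - b / a, \<mu>) | \<mu>. 0 \<le> \<mu> \<and> \<mu> \<le> - b / a} \<union>
     {(x, \<mu>) | x \<mu>. \<mu> = \<phi> x \<and> 0 < x \<and> x < 1 - b / a}"

text \<open>A function on \<open>[0, 1 - b/a]\<close> is a total function of which only the values on that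
  interval matter. The representation of the zero set involves only the values on the open
  interval, so it determines \<open>\<phi>\<close> there; the two endpoint values are determined only together
  with continuity on the closed interval.\<close>

definition describes_zeros :: "real \<Rightarrow> real \<Rightarrow> (real \<Rightarrow> real) \<Rightarrow> bool" where
  "describes_zeros a b \<phi> \<longleftrightarrow>
     \<phi> \<in> {0..1 - b / a} \<rightarrow> {0<..} \<and>
     M a b -` {0} =
       {(0, \<mu>) | \<mu>. True} \<union> Z1 a b \<phi> \<union> S1 ` Z1 a b \<phi> \<union> S2 ` Z1 a b \<phi> \<union> S2 ` (S1 ` Z1 a b \<phi>)"

end

theory Submission
  imports Defs
begin

text \<open>
  The clamping of \<open>y\<close> to \<open>[-1, 1]\<close> is \<open>(\<bar>y + 1\<bar> - \<bar>y - 1\<bar>) / 2\<close>, and \<open>\<integral>\<bar>z - cos t\<bar> dt = 4 h z\<close> over a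
  period, where \<open>h\<close> is the convex \<open>C\<^sup>1\<close> function with \<open>h' z = arcsin\<close> of the clamped \<open>z\<close>. Hence, up
  to the factor \<open>2 (b - a)\<close>, \<open>M (x, \<mu>)\<close> is
  \<open>\<mu> (h ((x + 1) / \<mu>) - h ((x - 1) / \<mu>)) - (\<pi> - c) x\<close>. With \<open>P, Q = h' ((x \<plusminus> 1) / \<mu>)\<close> its gradient
  is \<open>(P - Q - (\<pi> - c), cos P - cos Q)\<close>. For \<open>x > 0\<close> it is strictly decreasing in \<open>\<mu> \<ge> \<bar>x - 1\<bar>\<close>,
  which yields \<open>\<phi>\<close>, and the sign of \<open>\<phi>'\<close> is that of \<open>P - Q - (\<pi> - c)\<close>. On the curve this sign is
  found from \<open>u cos u < sin u\<close> on \<open>(0, \<pi>)\<close>, separately for \<open>\<mu> > x + 1\<close>, where both ends of the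
  range of \<open>x - \<mu> cos t\<close> are clamped, and for \<open>\<mu> \<le> x + 1\<close>, where only the upper one is.
\<close>

section \<open>Derivative of a continuous implicit function of one variable\<close>

text \<open>As continuity of \<open>f\<close> is given, differentiability of \<open>F\<close> at the
  single point suffices. The error of the linear approximation of \<open>F\<close> involves the
  increment of \<open>f\<close> itself, so that increment is first bounded by a multiple of
  \<open>x - x0\<close>.\<close>

lemma implicit_function_derivative:
  fixes F :: "real \<times> real \<Rightarrow> real"
  assumes F: "(F has_derivative (\<lambda>(h, k). p * h + q * k)) (at (x0, f x0))"
    and q: "q \<noteq> 0"
    and cont: "isCont f x0"
    and zero: "eventually (\<lambda>x. F (x, f x) = 0) (nhds x0)"
  shows "(f has_real_derivative - p / q) (at x0)"
proof -
  define L where "L = - p / q"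
  have F0: "F (x0, f x0) = 0"
    using eventually_nhds_x_imp_x[OF zero] .
  have "\<exists>d>0. \<forall>x. norm (x - x0) < d \<longrightarrow> norm (f x - f x0 - L * (x - x0)) \<le> e * norm (x - x0)"
    if "e > 0" for e
  proof -
    \<comment> \<open>The bound 1/2 allows \<open>?k\<close> to be absorbed into the left-hand side,
      which gives \<open>\<bar>?h\<bar> + \<bar>?k\<bar> \<le> (2 * \<bar>L\<bar> + 2) *
      \<bar>?h\<bar>\<close>; the other bound turns this into the error
      \<open>e * \<bar>?h\<bar>\<close>.\<close>
    define \<eta> where "\<eta> = min (1/2) (e / (2 * \<bar>L\<bar> + 2))"
    have \<eta>: "\<eta> > 0" "\<eta> \<le> 1/2" "\<eta> \<le> e / (2 * \<bar>L\<bar> + 2)"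
      unfolding \<eta>_def using that by (simp_all only: min.cobounded1 min.cobounded2) simp
    have \<eta>_e: "\<eta> * (2 * \<bar>L\<bar> + 2) \<le> e"
      using \<eta>(3) by (subst (asm) pos_le_divide_eq) auto
    have "\<eta> * \<bar>q\<bar> > 0"
      using \<eta> q by simp
    with F obtain d where d: "d > 0" and
      approx: "\<And>z. norm (z - (x0, f x0)) < d \<Longrightarrow>
        norm (F z - F (x0, f x0) - (case z - (x0, f x0) of (h, k) \<Rightarrow> p * h + q * k))
          \<le> \<eta> * \<bar>q\<bar> * norm (z - (x0, f x0))"
      unfolding has_derivative_at_alt by blast
    have "((\<lambda>x. (x, f x)) \<longlongrightarrow> (x0, f x0)) (nhds x0)"
      using cont by (intro tendsto_intros) (auto simp: isCont_def tendsto_at_iff_tendsto_nhds filterlim_ident)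
    hence "eventually (\<lambda>x. dist (x, f x) (x0, f x0) < d) (nhds x0)"
      using d by (rule tendstoD)
    with zero have "eventually (\<lambda>x. dist (x, f x) (x0, f x0) < d \<and> F (x, f x) = 0) (nhds x0)"
      by eventually_elim simp
    then obtain d' where d': "d' > 0"
      and near: "\<And>x. dist x x0 < d' \<Longrightarrow> dist (x, f x) (x0, f x0) < d \<and> F (x, f x) = 0"
      unfolding eventually_nhds_metric by blast
    have "norm (f x - f x0 - L * (x - x0)) \<le> e * norm (x - x0)" if x: "norm (x - x0) < d'" for x
    proof -
      let ?h = "x - x0" and ?k = "f x - f x0"
      have "\<bar>p * ?h + q * ?k\<bar> \<le> \<eta> * \<bar>q\<bar> * norm (?h, ?k)"
        using approx[of "(x, f x)"] near[of x] x by (simp add: dist_norm F0 abs_minus_commute)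
      also have "\<dots> \<le> \<eta> * \<bar>q\<bar> * (\<bar>?h\<bar> + \<bar>?k\<bar>)"
        using \<eta> q norm_Pair_le[of ?h ?k] by (intro mult_left_mono) auto
      also have "p * ?h + q * ?k = q * (?k - L * ?h)"
        using q by (simp add: L_def field_simps)
      finally have *: "\<bar>?k - L * ?h\<bar> \<le> \<eta> * (\<bar>?h\<bar> + \<bar>?k\<bar>)"
        using q by (simp add: abs_mult mult.assoc mult.left_commute)
      also have "\<dots> \<le> 1/2 * (\<bar>?h\<bar> + \<bar>?k\<bar>)"
        using \<eta> by (intro mult_right_mono) auto
      finally have "\<bar>?k\<bar> \<le> 2 * (\<bar>L\<bar> * \<bar>?h\<bar>) + \<bar>?h\<bar>"
        using abs_triangle_ineq2[of ?k "L * ?h"] abs_mult[of L ?h] by argo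
      hence "\<bar>?h\<bar> + \<bar>?k\<bar> \<le> (2 * \<bar>L\<bar> + 2) * \<bar>?h\<bar>"
        by (simp add: distrib_right mult.assoc)
      with * \<eta> have "\<bar>?k - L * ?h\<bar> \<le> \<eta> * ((2 * \<bar>L\<bar> + 2) * \<bar>?h\<bar>)"
        by (meson mult_left_mono less_imp_le order_trans)
      also have "\<dots> \<le> e * \<bar>?h\<bar>"
        using \<eta>_e by (simp add: mult_right_mono flip: mult.assoc)
      finally show ?thesis
        by simp
    qed
    with d' show ?thesis
      by blast
  qed
  hence "(f has_derivative (*) L) (at x0)"
    unfolding has_derivative_at_alt by (auto intro: bounded_linear_mult_right)
  thus ?thesis
    by (simp add: has_field_derivative_def L_def)
qed

section \<open>Two trigonometric inequalities\<close>

text \<open>The difference \<open>sin t - t * cos t\<close> vanishes at 0 and has derivative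
  \<open>t * sin t\<close>.\<close>

lemma mult_cos_less_sin:
  fixes x :: real
  assumes "0 < x" "x < pi"
  shows "x * cos x < sin x"
proof -
  have "sin 0 - 0 * cos 0 < sin x - x * cos x"
  proof (rule DERIV_pos_imp_increasing_open[of 0 x "\<lambda>t. sin t - t * cos t"])
    show "\<exists>y. DERIV (\<lambda>t. sin t - t * cos t) t :> y \<and> 0 < y" if "0 < t" "t < x" for t
    proof (intro exI conjI)
      show "DERIV (\<lambda>t. sin t - t * cos t) t :> t * sin t"
        by (auto intro!: derivative_eq_intros)
      show "0 < t * sin t"
        using that assms by (simp add: sin_gt_zero)
    qed
  qed (use assms in \<open>auto intro!: continuous_intros\<close>)
  thus ?thesis
    by simp
qed

text \<open>This is the previous inequality at \<open>x/2\<close>, multiplied by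
  \<open>4 * cos (x/2)\<close>.\<close>

lemma mult_one_plus_cos_less_sin:
  fixes x :: real
  assumes "0 < x" "x < pi"
  shows "x * (1 + cos x) < 2 * sin x"
proof -
  have *: "x/2 * cos (x/2) < sin (x/2)"
    using assms by (intro mult_cos_less_sin) auto
  have c: "cos (x/2) > 0"
    using assms by (intro cos_gt_zero_pi) auto
  have "x * (1 + cos x) = 4 * cos (x/2) * (x/2 * cos (x/2))"
    using cos_double_cos[of "x/2"] by (simp add: power2_eq_square)
  also have "\<dots> < 4 * cos (x/2) * sin (x/2)"
    using * c by (intro mult_strict_left_mono) auto
  also have "\<dots> = 2 * sin x"
    using sin_double[of "x/2"] by simp
  finally show ?thesis .
qed

section \<open>The clamped arcsine and its convex primitive\<close>

definition clamped_arcsin :: "real \<Rightarrow> real" where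
  "clamped_arcsin z = arcsin (max (-1) (min 1 z))"

text \<open>On [-1, 1] this is the usual primitive \<open>z * arcsin z + sqrt (1 - z^2)\<close>;
  outside, the cosine vanishes and \<open>pi / 2 * \<bar>z\<bar>\<close> remains.\<close>

definition arcsin_primitive :: "real \<Rightarrow> real" where
  "arcsin_primitive z = z * clamped_arcsin z + cos (clamped_arcsin z)"

lemma clamped_arcsin_bounds:
  "- (pi / 2) \<le> clamped_arcsin z" "clamped_arcsin z \<le> pi / 2"
  unfolding clamped_arcsin_def
  using arcsin_lbound[of "max (-1) (min 1 z)"] arcsin_ubound[of "max (-1) (min 1 z)"] by auto

lemma sin_clamped_arcsin: "sin (clamped_arcsin z) = max (-1) (min 1 z)"
  unfolding clamped_arcsin_def by (intro sin_arcsin) auto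

lemma sin_clamped_arcsin_eq: "\<bar>z\<bar> \<le> 1 \<Longrightarrow> sin (clamped_arcsin z) = z"
  by (auto simp: sin_clamped_arcsin)

lemma clamped_arcsin_sin: "\<bar>t\<bar> \<le> pi / 2 \<Longrightarrow> clamped_arcsin (sin t) = t"
  by (simp add: clamped_arcsin_def arcsin_sin abs_le_iff)

lemma clamped_arcsin_ge_1: "z \<ge> 1 \<Longrightarrow> clamped_arcsin z = pi / 2"
  by (simp add: clamped_arcsin_def max_def min_def)

lemma clamped_arcsin_minus: "clamped_arcsin (- z) = - clamped_arcsin z"
proof -
  have "max (-1) (min 1 (- z)) = - max (-1) (min 1 z)"
    by (auto simp: max_def min_def)
  thus ?thesis
    unfolding clamped_arcsin_def by (auto intro: arcsin_minus)
qed

text \<open>The side conditions say that the two arguments do not lie on the same plateau.\<close>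

lemma clamped_arcsin_less: "z < w \<Longrightarrow> -1 < w \<Longrightarrow> z < 1 \<Longrightarrow> clamped_arcsin z < clamped_arcsin w"
  unfolding clamped_arcsin_def by (intro arcsin_less_arcsin) (auto simp: max_def min_def)

lemma isCont_clamped_arcsin: "isCont clamped_arcsin z"
proof -
  have "continuous_on UNIV clamped_arcsin"
    unfolding clamped_arcsin_def by (intro continuous_intros) auto
  thus ?thesis
    by (simp add: continuous_on_eq_continuous_at)
qed

lemma arcsin_primitive_minus: "arcsin_primitive (- z) = arcsin_primitive z"
  by (simp add: arcsin_primitive_def clamped_arcsin_minus)

lemma arcsin_primitive_ge_1: "z \<ge> 1 \<Longrightarrow> arcsin_primitive z = pi / 2 * z"
  by (simp add: arcsin_primitive_def clamped_arcsin_ge_1)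

text \<open>Cosine is concave on this interval: by the mean value theorem the claim reduces to
  monotonicity of sine.\<close>

lemma cos_le_tangent:
  fixes t B :: real
  assumes "\<bar>t\<bar> \<le> pi / 2" "\<bar>B\<bar> \<le> pi / 2"
  shows "cos t \<le> cos B - sin B * (t - B)"
proof -
  consider "t = B" | "t < B" | "B < t"
    by linarith
  thus ?thesis
  proof cases
    case 2
    then obtain u where u: "t < u" "u < B" "cos B - cos t = (B - t) * - sin u"
      using MVT2[OF 2, of cos "\<lambda>u. - sin u"] by (auto intro: DERIV_cos)
    have "sin u \<le> sin B"
      using u assms by (intro sin_monotone_2pi_le) auto
    hence "(B - t) * sin u \<le> (B - t) * sin B"
      using 2 by (intro mult_left_mono) auto
    with u(3) show ?thesis
      by (simp add: algebra_simps)
  next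
    case 3
    then obtain u where u: "B < u" "u < t" "cos t - cos B = (t - B) * - sin u"
      using MVT2[OF 3, of cos "\<lambda>u. - sin u"] by (auto intro: DERIV_cos)
    have "sin B \<le> sin u"
      using u assms by (intro sin_monotone_2pi_le) auto
    hence "(t - B) * sin B \<le> (t - B) * sin u"
      using 3 by (intro mult_left_mono) auto
    with u(3) show ?thesis
      by (simp add: algebra_simps)
  qed auto
qed

text \<open>\<^const>\<open>arcsin_primitive\<close> is the Legendre transform of \<open>- cos\<close> on \<open>[-\<pi>/2, \<pi>/2]\<close>, which makes
  it convex with subgradient \<^const>\<open>clamped_arcsin\<close>, also at the kinks \<open>\<plusminus>1\<close> of the clamping.\<close>

lemma arcsin_primitive_ge:
  assumes t: "\<bar>t\<bar> \<le> pi / 2"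
  shows "z * t + cos t \<le> arcsin_primitive z"
proof -
  define B where "B = clamped_arcsin z"
  have B: "\<bar>B\<bar> \<le> pi / 2"
    using clamped_arcsin_bounds[of z] by (auto simp: B_def)
  have sinB: "sin B = max (-1) (min 1 z)"
    by (simp add: B_def sin_clamped_arcsin)
  \<comment> \<open>Optimality of \<open>B\<close>: either \<open>z = sin B\<close>, or
    \<open>B\<close> is the end of the interval towards which \<open>z - sin B\<close> points, so no
    admissible \<open>t\<close> lies further in that direction. Added to the tangent inequality,
    this is the claim.\<close>
  have "(z - sin B) * (t - B) \<le> 0"
  proof -
    consider "\<bar>z\<bar> \<le> 1" | "z > 1" | "z < -1"
      by linarith
    thus ?thesis
    proof cases
      case 1
      thus ?thesis using sinB by simp
    next
      case 2
      hence "B = pi / 2"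
        by (simp add: B_def clamped_arcsin_ge_1)
      with 2 t sin_le_one[of B] show ?thesis
        by (intro mult_nonneg_nonpos) linarith+
    next
      case 3
      hence "B = - (pi / 2)"
        using clamped_arcsin_ge_1[of "- z"] by (simp add: B_def clamped_arcsin_minus)
      with 3 t sin_ge_minus_one[of B] show ?thesis
        by (intro mult_nonpos_nonneg) linarith+
    qed
  qed
  with cos_le_tangent[OF t B] show ?thesis
    by (simp add: arcsin_primitive_def flip: B_def) (simp add: algebra_simps)
qed

text \<open>The bound \<open>arcsin_primitive_ge\<close> at \<open>w\<close> with
  \<open>t = clamped_arcsin z\<close>, which at \<open>z\<close> itself is an equality.\<close>

lemma arcsin_primitive_subgradient:
  "clamped_arcsin z * (w - z) \<le> arcsin_primitive w - arcsin_primitive z"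
  using arcsin_primitive_ge[of "clamped_arcsin z" w] clamped_arcsin_bounds[of z]
  by (simp add: arcsin_primitive_def[of z] algebra_simps abs_le_iff)

text \<open>The two ends \<open>t = pi / 2\<close> and \<open>t = - (pi / 2)\<close> of
  \<open>arcsin_primitive_ge\<close>. With the next lemma the primitive stays within 1 of its
  asymptotes, which controls \<open>balance\<close> for small \<open>m\<close>.\<close>

lemma arcsin_primitive_ge_abs: "pi / 2 * \<bar>z\<bar> \<le> arcsin_primitive z"
  using arcsin_primitive_ge[of "pi / 2" z] arcsin_primitive_ge[of "- (pi / 2)" z]
  by (auto simp: abs_if mult.commute)

lemma arcsin_primitive_le_abs: "arcsin_primitive z \<le> pi / 2 * \<bar>z\<bar> + 1"
proof -
  have "z * clamped_arcsin z \<le> \<bar>z\<bar> * \<bar>clamped_arcsin z\<bar>"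
    by (metis abs_ge_self abs_mult)
  also have "\<dots> \<le> \<bar>z\<bar> * (pi / 2)"
    using clamped_arcsin_bounds[of z] by (intro mult_left_mono) auto
  finally show ?thesis
    using cos_le_one[of "clamped_arcsin z"]
    unfolding arcsin_primitive_def mult.commute[of "pi / 2"] by linarith
qed

text \<open>The difference quotient lies between the subgradients at \<open>z\<close> and
  \<open>w\<close>, so continuity of \<open>clamped_arcsin\<close> squeezes it. No separate
  treatment of the points 1 and -1 is needed.\<close>

lemma DERIV_arcsin_primitive: "(arcsin_primitive has_real_derivative clamped_arcsin z) (at z)"
proof -
  have "((\<lambda>w. (arcsin_primitive w - arcsin_primitive z) / (w - z) - clamped_arcsin z) \<longlongrightarrow> 0) (at z)"
  proof (rule Lim_null_comparison)
    have "((\<lambda>w. clamped_arcsin w - clamped_arcsin z) \<longlongrightarrow> 0) (at z)"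
      using isCont_clamped_arcsin[of z] by (simp add: isCont_def LIM_zero)
    thus "((\<lambda>w. \<bar>clamped_arcsin w - clamped_arcsin z\<bar>) \<longlongrightarrow> 0) (at z)"
      by (rule tendsto_rabs_zero)
    show "\<forall>\<^sub>F w in at z. norm ((arcsin_primitive w - arcsin_primitive z) / (w - z) - clamped_arcsin z)
            \<le> \<bar>clamped_arcsin w - clamped_arcsin z\<bar>"
      unfolding eventually_at_filter
    proof (intro always_eventually allI impI)
      fix w assume "w \<noteq> z"
      let ?D = "arcsin_primitive w - arcsin_primitive z"
      have D: "clamped_arcsin z * (w - z) \<le> ?D" "?D \<le> clamped_arcsin w * (w - z)"
        using arcsin_primitive_subgradient[of z w] arcsin_primitive_subgradient[of w z]
        by (auto simp: algebra_simps)
      show "norm (?D / (w - z) - clamped_arcsin z) \<le> \<bar>clamped_arcsin w - clamped_arcsin z\<bar>"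
      proof (cases "w > z")
        case True
        hence "clamped_arcsin z \<le> ?D / (w - z)" "?D / (w - z) \<le> clamped_arcsin w"
          using D by (simp_all add: pos_le_divide_eq pos_divide_le_eq)
        thus ?thesis
          by simp
      next
        case False
        hence "clamped_arcsin w \<le> ?D / (w - z)" "?D / (w - z) \<le> clamped_arcsin z"
          using D \<open>w \<noteq> z\<close> by (simp_all add: neg_le_divide_eq neg_divide_le_eq)
        thus ?thesis
          by simp
      qed
    qed
  qed
  thus ?thesis
    unfolding has_field_derivative_iff by (simp add: LIM_zero_iff)
qed

section \<open>Integrals of absolute values over a period\<close>

lemma has_integral_abs_diff_cos:
  "((\<lambda>t. \<bar>z - cos t\<bar>) has_integral 4 * arcsin_primitive z) {0..2 * pi}"
proof -
  have FTC: "((\<lambda>t. z - cos t) has_integral (z * v - sin v) - (z * u - sin u)) {u..v}" if "u \<le> v" for u v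
    using that by (intro fundamental_theorem_of_calculus)
      (auto intro!: derivative_eq_intros simp flip: has_real_derivative_iff_has_vector_derivative)
  have FTC': "((\<lambda>t. cos t - z) has_integral (sin v - z * v) - (sin u - z * u)) {u..v}" if "u \<le> v" for u v
    using has_integral_neg[OF FTC[OF that]] by (simp add: algebra_simps)
  consider "z \<ge> 1" | "z \<le> -1" | "\<bar>z\<bar> < 1"
    by linarith
  thus ?thesis
  proof cases
    case 1
    have "((\<lambda>t. z - cos t) has_integral 4 * arcsin_primitive z) {0..2 * pi}"
      using FTC[of 0 "2 * pi"] 1 by (simp add: arcsin_primitive_ge_1 mult_ac)
    moreover have "z - cos t = \<bar>z - cos t\<bar>" for t
      using 1 cos_le_one[of t] by linarith
    ultimately show ?thesis
      by simp
  next
    case 2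
    have "((\<lambda>t. cos t - z) has_integral 4 * arcsin_primitive z) {0..2 * pi}"
      using FTC'[of 0 "2 * pi"] 2 arcsin_primitive_ge_1[of "- z"]
      by (simp add: arcsin_primitive_minus mult_ac)
    moreover have "cos t - z = \<bar>z - cos t\<bar>" for t
      using 2 cos_ge_minus_one[of t] by linarith
    ultimately show ?thesis
      by simp
  next
    case 3
    \<comment> \<open>This is arccos of \<open>z\<close>: the integrand changes sign exactly at
      \<open>\<theta>\<close> and \<open>2 * pi - \<theta>\<close>, where the period is
      split.\<close>
    define \<theta> where "\<theta> = pi / 2 - clamped_arcsin z"
    have \<theta>: "0 \<le> \<theta>" "\<theta> \<le> pi"
      using clamped_arcsin_bounds[of z] by (auto simp: \<theta>_def)
    have cos_\<theta>: "cos \<theta> = z" and sin_\<theta>: "sin \<theta> = cos (clamped_arcsin z)"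
      using 3 by (auto simp: \<theta>_def cos_diff sin_diff sin_clamped_arcsin_eq)
    have "((\<lambda>t. \<bar>z - cos t\<bar>) has_integral (sin \<theta> - z * \<theta>) - (sin 0 - z * 0)) {0..\<theta>}"
    proof (rule has_integral_eq[OF _ FTC'])
      fix t assume "t \<in> {0..\<theta>}"
      hence "z \<le> cos t"
        unfolding cos_\<theta>[symmetric] using \<theta> by (intro cos_monotone_0_pi_le) auto
      thus "cos t - z = \<bar>z - cos t\<bar>"
        by simp
    qed fact
    moreover have "((\<lambda>t. \<bar>z - cos t\<bar>) has_integral
        (z * (2 * pi - \<theta>) - sin (2 * pi - \<theta>)) - (z * \<theta> - sin \<theta>)) {\<theta>..2 * pi - \<theta>}"
    proof (rule has_integral_eq[OF _ FTC])
      fix t assume t: "t \<in> {\<theta>..2 * pi - \<theta>}"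
      have "cos t \<le> z"
      proof (cases "t \<le> pi")
        case True
        thus ?thesis
          unfolding cos_\<theta>[symmetric] using \<theta> t by (intro cos_monotone_0_pi_le) auto
      next
        case False
        have "cos (2 * pi - t) \<le> cos \<theta>"
          using \<theta> t False by (intro cos_monotone_0_pi_le) auto
        thus ?thesis
          by (simp add: cos_\<theta> cos_diff)
      qed
      thus "z - cos t = \<bar>z - cos t\<bar>"
        by simp
    qed (use \<theta> in auto)
    moreover have "((\<lambda>t. \<bar>z - cos t\<bar>) has_integral
        (sin (2 * pi) - z * (2 * pi)) - (sin (2 * pi - \<theta>) - z * (2 * pi - \<theta>))) {2 * pi - \<theta>..2 * pi}"
    proof (rule has_integral_eq[OF _ FTC'])
      fix t assume t: "t \<in> {2 * pi - \<theta>..2 * pi}"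
      have "cos \<theta> \<le> cos (2 * pi - t)"
        using \<theta> t by (intro cos_monotone_0_pi_le) auto
      thus "cos t - z = \<bar>z - cos t\<bar>"
        by (simp add: cos_\<theta> cos_diff)
    qed (use \<theta> in auto)
    ultimately have "((\<lambda>t. \<bar>z - cos t\<bar>) has_integral
       ((sin \<theta> - z * \<theta>) - (sin 0 - z * 0) +
       ((z * (2 * pi - \<theta>) - sin (2 * pi - \<theta>)) - (z * \<theta> - sin \<theta>))) +
       ((sin (2 * pi) - z * (2 * pi)) - (sin (2 * pi - \<theta>) - z * (2 * pi - \<theta>)))) {0..2 * pi}"
      using \<theta> by (intro has_integral_combine[of 0 "2 * pi - \<theta>" "2 * pi"]
        has_integral_combine[of 0 \<theta> "2 * pi - \<theta>"]) auto
    also have "((sin \<theta> - z * \<theta>) - (sin 0 - z * 0) +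
       ((z * (2 * pi - \<theta>) - sin (2 * pi - \<theta>)) - (z * \<theta> - sin \<theta>))) +
       ((sin (2 * pi) - z * (2 * pi)) - (sin (2 * pi - \<theta>) - z * (2 * pi - \<theta>))) = 4 * arcsin_primitive z"
      by (simp add: sin_diff arcsin_primitive_def sin_\<theta>) (simp add: \<theta>_def algebra_simps)
    finally show ?thesis .
  qed
qed

text \<open>The factor \<open>\<bar>m\<bar>\<close> is pulled out; the sign of \<open>m\<close>
  disappears because \<open>arcsin_primitive\<close> is even.\<close>

lemma has_integral_abs_diff_mult_cos:
  assumes "m \<noteq> 0"
  shows "((\<lambda>t. \<bar>u - m * cos t\<bar>) has_integral 4 * \<bar>m\<bar> * arcsin_primitive (u / \<bar>m\<bar>)) {0..2 * pi}"
proof -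
  have "((\<lambda>t. \<bar>m\<bar> * \<bar>u / m - cos t\<bar>) has_integral \<bar>m\<bar> * (4 * arcsin_primitive (u / m))) {0..2 * pi}"
    by (intro has_integral_mult_right has_integral_abs_diff_cos)
  moreover have "\<bar>m\<bar> * \<bar>u / m - cos t\<bar> = \<bar>u - m * cos t\<bar>" for t
    using assms by (simp add: field_simps flip: abs_mult)
  moreover have "arcsin_primitive (u / m) = arcsin_primitive (u / \<bar>m\<bar>)"
    using arcsin_primitive_minus[of "u / m"] by (auto simp: abs_if)
  ultimately show ?thesis
    by (simp add: mult_ac)
qed

section \<open>Reduction of \<open>M\<close> to a function with the single parameter
  \<open>c\<close>\<close>

text \<open>A linear function plus \<open>b - a\<close> times the clamping of \<open>y\<close>,
  written with absolute values so that the integrals above apply.\<close>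

lemma pwl_eq: "pwl a b y = a * y + (b - a) * (\<bar>y + 1\<bar> / 2 - \<bar>y - 1\<bar> / 2)"
proof -
  consider "y \<le> -1" | "-1 < y" "y < 1" | "y \<ge> 1"
    by linarith
  thus ?thesis
    by cases (auto simp: pwl_def field_simps)
qed

definition balance :: "real \<Rightarrow> real \<Rightarrow> real \<Rightarrow> real" where
  "balance c x m =
     m * (arcsin_primitive ((x + 1) / m) - arcsin_primitive ((x - 1) / m)) - (pi - c) * x"

text \<open>The hypothesis on \<open>c\<close> yields \<open>(b - a) * (pi - c) = - pi * a\<close>.
  Thus the linear term, too, is a multiple of \<open>b - a\<close>, and after division only
  \<open>c\<close> is left.\<close>

lemma M_eq_balance:
  assumes "\<mu> \<noteq> 0" and "(b - a) * c = pi * b"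
  shows "M a b (x, \<mu>) = 2 * (b - a) * balance c x \<bar>\<mu>\<bar>"
proof -
  let ?h = arcsin_primitive and ?m = "\<bar>\<mu>\<bar>"
  have lin: "((\<lambda>t. a * (x - \<mu> * cos t)) has_integral
      (a * (x * (2 * pi) - \<mu> * sin (2 * pi)) - a * (x * 0 - \<mu> * sin 0))) {0..2 * pi}"
    by (intro fundamental_theorem_of_calculus)
      (auto intro!: derivative_eq_intros simp flip: has_real_derivative_iff_has_vector_derivative)
  have shifted: "((\<lambda>t. \<bar>x - \<mu> * cos t + 1\<bar>) has_integral 4 * ?m * ?h ((x + 1) / ?m)) {0..2 * pi}"
    "((\<lambda>t. \<bar>x - \<mu> * cos t - 1\<bar>) has_integral 4 * ?m * ?h ((x - 1) / ?m)) {0..2 * pi}"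
    using has_integral_abs_diff_mult_cos[OF assms(1), of "x + 1"]
      has_integral_abs_diff_mult_cos[OF assms(1), of "x - 1"]
    by (simp_all add: algebra_simps)
  have "((\<lambda>t. pwl a b (x - \<mu> * cos t)) has_integral
      (a * (x * (2 * pi) - \<mu> * sin (2 * pi)) - a * (x * 0 - \<mu> * sin 0)) +
        (b - a) * (4 * ?m * ?h ((x + 1) / ?m) / 2 - 4 * ?m * ?h ((x - 1) / ?m) / 2)) {0..2 * pi}"
    unfolding pwl_eq
    by (intro has_integral_add has_integral_mult_right has_integral_diff has_integral_divide
      lin shifted)
  hence "M a b (x, \<mu>) = 2 * pi * a * x + 2 * (b - a) * ?m * (?h ((x + 1) / ?m) - ?h ((x - 1) / ?m))"
    unfolding M_def prod.case by (subst integral_unique) (auto simp: algebra_simps)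
  moreover have "(b - a) * (pi - c) = - pi * a"
    using assms by (simp add: algebra_simps)
  hence "(b - a) * (pi - c) * x = - pi * a * x"
    by simp
  ultimately show ?thesis
    by (simp add: balance_def algebra_simps)
qed

lemma M_zero: "M a b (x, 0) = 2 * pi * pwl a b x"
  by (simp add: M_def)

lemma balance_expand:
  fixes c x m :: real
  assumes "m \<noteq> 0"
  defines "P \<equiv> clamped_arcsin ((x + 1) / m)" and "Q \<equiv> clamped_arcsin ((x - 1) / m)"
  shows "balance c x m = (x + 1) * P + m * cos P - ((x - 1) * Q + m * cos Q) - (pi - c) * x"
  using assms(1) unfolding balance_def arcsin_primitive_def P_def[symmetric] Q_def[symmetric]
  by (simp add: right_diff_distrib distrib_left)

section \<open>Gradient and monotonicity of \<open>balance\<close>\<close>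

locale clamped_balance =
  fixes c :: real
  assumes c_pos: "0 < c" and c_less: "c < pi"
begin

text \<open>The number 1 - b/a in terms of \<open>c\<close>; see \<open>width_eq\<close>.\<close>

definition width :: real where
  "width = pi / (pi - c)"

lemma width_gt_1: "width > 1"
  using c_pos c_less by (simp add: width_def field_simps)

lemma width_mult: "(pi - c) * width = pi"
  using c_less by (simp add: width_def)

lemma less_width_iff: "x < width \<longleftrightarrow> (pi - c) * x < pi"
  using c_less by (simp add: width_def field_simps)

text \<open>The coefficient of \<open>k\<close> is a difference of cosines because
  \<open>arcsin_primitive z - z * clamped_arcsin z\<close> is the cosine of
  \<open>clamped_arcsin z\<close>. The joint derivative is what implicit differentiation
  requires.\<close>

lemma has_derivative_balance:
  fixes x m :: real
  assumes "m > 0"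
  defines "P \<equiv> clamped_arcsin ((x + 1) / m)" and "Q \<equiv> clamped_arcsin ((x - 1) / m)"
  shows "((\<lambda>(x, m). balance c x m) has_derivative
    (\<lambda>(h, k). (P - Q - (pi - c)) * h + (cos P - cos Q) * k)) (at (x, m))"
proof -
  let ?h = arcsin_primitive
  have "((\<lambda>z. snd z * (?h ((fst z + 1) / snd z) - ?h ((fst z - 1) / snd z)) - (pi - c) * fst z)
    has_derivative (\<lambda>z. m * (P * ((m * fst z - (x + 1) * snd z) / m\<^sup>2)
        - Q * ((m * fst z - (x - 1) * snd z) / m\<^sup>2))
      + snd z * (?h ((x + 1) / m) - ?h ((x - 1) / m)) - (pi - c) * fst z)) (at (x, m))"
    using \<open>m > 0\<close>
    by (auto intro!: derivative_eq_intros DERIV_compose_FDERIV[OF DERIV_arcsin_primitive]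
      simp: P_def Q_def field_simps power2_eq_square fun_eq_iff)
  also have "(\<lambda>z. m * (P * ((m * fst z - (x + 1) * snd z) / m\<^sup>2)
        - Q * ((m * fst z - (x - 1) * snd z) / m\<^sup>2))
      + snd z * (?h ((x + 1) / m) - ?h ((x - 1) / m)) - (pi - c) * fst z) =
    (\<lambda>(h, k). (P - Q - (pi - c)) * h + (cos P - cos Q) * k)"
    using \<open>m > 0\<close>
    by (simp add: fun_eq_iff arcsin_primitive_def flip: P_def Q_def)
      (simp add: field_simps power2_eq_square)
  finally show ?thesis
    by (simp add: balance_def case_prod_unfold)
qed

lemma DERIV_balance_left:
  assumes "m > 0"
  shows "((\<lambda>x. balance c x m) has_real_derivative
    clamped_arcsin ((x + 1) / m) - clamped_arcsin ((x - 1) / m) - (pi - c)) (at x)"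
  unfolding balance_def
  using assms by (auto intro!: derivative_eq_intros DERIV_chain2[OF DERIV_arcsin_primitive] simp: field_simps)

lemma DERIV_balance_right:
  fixes x m :: real
  assumes "m > 0"
  defines "P \<equiv> clamped_arcsin ((x + 1) / m)" and "Q \<equiv> clamped_arcsin ((x - 1) / m)"
  shows "((\<lambda>m. balance c x m) has_real_derivative cos P - cos Q) (at m)"
proof (rule DERIV_cong)
  let ?h = arcsin_primitive
  show "((\<lambda>m. balance c x m) has_real_derivative (?h ((x + 1) / m) - ?h ((x - 1) / m))
      + m * (Q * ((x - 1) / m\<^sup>2) - P * ((x + 1) / m\<^sup>2))) (at m)"
    unfolding balance_def using assms(1)
    by (auto intro!: derivative_eq_intros DERIV_chain2[OF DERIV_arcsin_primitive]
      simp: P_def Q_def field_simps power2_eq_square)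
  show "(?h ((x + 1) / m) - ?h ((x - 1) / m))
      + m * (Q * ((x - 1) / m\<^sup>2) - P * ((x + 1) / m\<^sup>2)) = cos P - cos Q"
    using assms(1)
    by (simp add: arcsin_primitive_def flip: P_def Q_def) (simp add: field_simps power2_eq_square)
qed

lemma balance_minus: "balance c (- x) m = - balance c x m"
proof -
  have "(- x + 1) / m = - ((x - 1) / m)" "(- x - 1) / m = - ((x + 1) / m)"
    by (simp_all add: add_divide_distrib diff_divide_distrib)
  thus ?thesis
    unfolding balance_def by (simp only: arcsin_primitive_minus) (simp add: algebra_simps)
qed

lemma balance_0: "balance c 0 m = 0"
  using balance_minus[of 0 m] by simp

text \<open>For \<open>x > 0\<close>, \<open>x + 1\<close> exceeds both \<open>x - 1\<close> and
  \<open>1 - x\<close>, and \<open>\<bar>x - 1\<bar> < m\<close> keeps \<open>(x - 1) / m\<close>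
  off the plateaus.\<close>

lemma clamped_arcsin_abs_less:
  assumes "0 < x" "\<bar>x - 1\<bar> < m"
  shows "\<bar>clamped_arcsin ((x - 1) / m)\<bar> < clamped_arcsin ((x + 1) / m)"
proof -
  have m: "m > 0"
    using assms by linarith
  have "clamped_arcsin ((x - 1) / m) < clamped_arcsin ((x + 1) / m)"
    using m assms by (intro clamped_arcsin_less) (auto simp: field_simps abs_less_iff)
  moreover have "clamped_arcsin (- ((x - 1) / m)) < clamped_arcsin ((x + 1) / m)"
    using m assms by (intro clamped_arcsin_less) (auto simp: field_simps abs_less_iff)
  ultimately show ?thesis
    by (simp add: clamped_arcsin_minus)
qed

lemma cos_clamped_arcsin_less:
  assumes "0 < x" "\<bar>x - 1\<bar> < m"
  shows "cos (clamped_arcsin ((x + 1) / m)) < cos (clamped_arcsin ((x - 1) / m))"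
proof -
  have "cos (clamped_arcsin ((x + 1) / m)) < cos \<bar>clamped_arcsin ((x - 1) / m)\<bar>"
    using clamped_arcsin_abs_less[OF assms] clamped_arcsin_bounds[of "(x + 1) / m"]
    by (intro cos_monotone_0_pi) auto
  thus ?thesis
    by simp
qed

lemma balance_strict_decreasing:
  assumes "0 < x" "\<bar>x - 1\<bar> \<le> m" "0 < m" "m < m'"
  shows "balance c x m' < balance c x m"
proof (rule DERIV_neg_imp_decreasing_open[OF \<open>m < m'\<close>])
  show "\<exists>y. DERIV (balance c x) t :> y \<and> y < 0" if "m < t" "t < m'" for t
    using DERIV_balance_right[of t x] cos_clamped_arcsin_less[of x t] that assms by force
  show "continuous_on {m..m'} (balance c x)"
    using assms by (intro continuous_at_imp_continuous_on ballI DERIV_isCont[OF DERIV_balance_right]) auto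
qed

text \<open>Both \<open>(x + 1) / m\<close> and \<open>(x - 1) / m\<close> have modulus at least 1,
  where the primitive is \<open>pi / 2 * \<bar>z\<bar>\<close>, so \<open>m\<close> cancels.\<close>

lemma balance_unclamped:
  assumes "0 < m" "m \<le> \<bar>x - 1\<bar>" "0 < x"
  shows "balance c x m = pi * min 1 x - (pi - c) * x"
proof (cases "x \<ge> 1")
  case True
  hence eqs: "arcsin_primitive ((x + 1) / m) = pi / 2 * ((x + 1) / m)"
    "arcsin_primitive ((x - 1) / m) = pi / 2 * ((x - 1) / m)"
    by (intro arcsin_primitive_ge_1; use assms in \<open>simp add: field_simps\<close>)+
  with True assms show ?thesis
    unfolding balance_def eqs by (simp add: field_simps)
next
  case False
  hence eqs: "arcsin_primitive ((x + 1) / m) = pi / 2 * ((x + 1) / m)"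
    "arcsin_primitive (- ((x - 1) / m)) = pi / 2 * (- ((x - 1) / m))"
    by (intro arcsin_primitive_ge_1; use assms in \<open>simp add: field_simps\<close>)+
  with False assms show ?thesis
    unfolding balance_def eqs(1) eqs(2)[unfolded arcsin_primitive_minus] by (simp add: field_simps)
qed

lemma min_minus_pos:
  assumes "0 < x" "x < width"
  shows "0 < pi * min 1 x - (pi - c) * x"
  using assms less_width_iff[of x] c_pos by (auto simp: min_def algebra_simps)

lemma balance_pos:
  assumes "0 < m" "m \<le> \<bar>x - 1\<bar>" "0 < x" "x < width"
  shows "0 < balance c x m"
  using balance_unclamped[of m x] min_minus_pos assms by simp

text \<open>This controls \<open>m\<close> near 0 uniformly in \<open>x\<close>, including
  \<open>x = 1\<close>, where no positive \<open>m\<close> satisfies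
  \<open>m \<le> \<bar>x - 1\<bar>\<close>.\<close>

lemma balance_ge:
  assumes "0 < x" "0 < m"
  shows "pi * min 1 x - (pi - c) * x - m \<le> balance c x m"
proof -
  have "pi / 2 * \<bar>x + 1\<bar> = m * (pi / 2 * \<bar>(x + 1) / m\<bar>)"
    using assms by (simp add: field_simps abs_divide)
  also have "\<dots> \<le> m * arcsin_primitive ((x + 1) / m)"
    using assms by (intro mult_left_mono arcsin_primitive_ge_abs) auto
  finally have 1: "pi / 2 * \<bar>x + 1\<bar> \<le> m * arcsin_primitive ((x + 1) / m)" .
  have "m * arcsin_primitive ((x - 1) / m) \<le> m * (pi / 2 * \<bar>(x - 1) / m\<bar> + 1)"
    using assms by (intro mult_left_mono arcsin_primitive_le_abs) auto
  also have "\<dots> = pi / 2 * \<bar>x - 1\<bar> + m"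
    using assms by (simp add: field_simps abs_divide)
  finally have 2: "m * arcsin_primitive ((x - 1) / m) \<le> pi / 2 * \<bar>x - 1\<bar> + m" .
  have "pi * min 1 x = pi / 2 * \<bar>x + 1\<bar> - pi / 2 * \<bar>x - 1\<bar>"
    using assms by (cases "x \<ge> 1") (auto simp: field_simps)
  with 1 2 show ?thesis
    by (simp add: balance_def algebra_simps)
qed

text \<open>Subgradient at \<open>(x + 1) / m\<close> over the step of length \<open>2 / m\<close>.
  The bound makes \<open>balance\<close> negative for large \<open>m\<close>, and for every
  \<open>m\<close> once \<open>x\<close> exceeds \<open>width\<close>.\<close>

lemma balance_le:
  assumes "0 < m"
  shows "balance c x m \<le> 2 * clamped_arcsin ((x + 1) / m) - (pi - c) * x"
proof -
  have "m * (arcsin_primitive ((x + 1) / m) - arcsin_primitive ((x - 1) / m)) \<le>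
    m * - (clamped_arcsin ((x + 1) / m) * ((x - 1) / m - (x + 1) / m))"
    using arcsin_primitive_subgradient[of "(x + 1) / m" "(x - 1) / m"] assms
    by (intro mult_left_mono) auto
  also have "\<dots> = 2 * clamped_arcsin ((x + 1) / m)"
    using assms by (simp add: field_simps)
  finally show ?thesis
    by (simp add: balance_def)
qed

lemma balance_neg_beyond_width:
  assumes "0 < m" "x > width"
  shows "balance c x m < 0"
proof -
  have "pi < (pi - c) * x"
    using less_width_iff[of x] assms width_mult c_less
    by (metis mult_strict_left_mono diff_gt_0_iff_gt)
  with balance_le[OF assms(1), of x] clamped_arcsin_bounds[of "(x + 1) / m"] show ?thesis
    by linarith
qed

text \<open>At \<open>x = width\<close> the constant value in \<open>balance_unclamped\<close> is 0,
  which produces the vertical segment of \<open>Z1\<close>; beyond \<open>width - 1\<close> strict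
  decrease takes over.\<close>

lemma balance_width:
  assumes "0 < m"
  shows "m \<le> width - 1 \<Longrightarrow> balance c width m = 0"
    and "width - 1 < m \<Longrightarrow> balance c width m < 0"
proof -
  have *: "balance c width m = 0" if "0 < m" "m \<le> width - 1" for m
    using balance_unclamped[of m width] that width_gt_1 width_mult by simp
  show "m \<le> width - 1 \<Longrightarrow> balance c width m = 0"
    using * assms by blast
  show "width - 1 < m \<Longrightarrow> balance c width m < 0"
    using balance_strict_decreasing[of width "width - 1" m] *[of "width - 1"] width_gt_1 by simp
qed

text \<open>Existence comes from the intermediate value theorem between a small and a large
  \<open>m\<close>. Every zero lies beyond \<open>\<bar>x - 1\<bar>\<close>, where strict decrease
  makes it unique.\<close>

lemma ex1_balance_zero:
  assumes x: "0 < x" "x < width"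
  shows "\<exists>!m. 0 < m \<and> balance c x m = 0"
proof -
  have gt: "\<bar>x - 1\<bar> < m" if "0 < m" "balance c x m = 0" for m
    using balance_pos[of m x] that x by force
  have "\<exists>m>0. balance c x m = 0"
  proof -
    \<comment> \<open>Half of the limit of \<open>balance\<close> as \<open>m\<close> tends to 0: by
      \<open>balance_ge\<close>, every positive \<open>l \<le> e\<close> gives a value of at least
      \<open>e\<close>.\<close>
    define e where "e = (pi * min 1 x - (pi - c) * x) / 2"
    have e: "e > 0"
      using min_minus_pos[OF x] by (simp add: e_def)
    \<comment> \<open>With \<open>m\<close> chosen so that \<open>(x + 1) / m = sin d\<close>, the
      upper bound \<open>balance_le\<close> becomes \<open>2 * d - 4 * d\<close>.\<close>
    define d where "d = (pi - c) * x / 4"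
    have "0 < (pi - c) * x" "(pi - c) * x < pi"
      using x less_width_iff[of x] c_less by auto
    hence "0 < d" "d < pi / 4"
      unfolding d_def by (simp_all only: divide_pos_pos divide_strict_right_mono zero_less_numeral)
    hence d: "0 < d" "d < pi / 2"
      using pi_gt_zero by linarith+
    define m where "m = (x + 1) / sin d"
    have m: "m > 0"
      using d x by (auto simp: m_def intro!: divide_pos_pos sin_gt_zero)
    have "(x + 1) / m = sin d"
      using x by (simp add: m_def)
    hence "balance c x m \<le> 2 * d - (pi - c) * x"
      using balance_le[OF m, of x] d by (simp add: clamped_arcsin_sin)
    also have "\<dots> < 0"
    proof -
      have "(pi - c) * x = 4 * d"
        by (simp add: d_def)
      with d show ?thesis
        by linarith
    qed
    finally have neg: "balance c x m < 0" .
    define l where "l = min e m"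
    have l: "0 < l" "l \<le> m" "l \<le> e"
      using e m by (auto simp: l_def)
    have pos: "0 < balance c x l"
      using balance_ge[of x l] l e x by (simp add: e_def)
    have "\<exists>t\<ge>l. t \<le> m \<and> balance c x t = 0"
    proof (rule IVT2')
      show "continuous_on {l..m} (balance c x)"
        using l by (intro continuous_at_imp_continuous_on ballI DERIV_isCont[OF DERIV_balance_right]) auto
    qed (use neg pos l in auto)
    with l show ?thesis
      by (metis order.strict_trans2)
  qed
  moreover have "m = m'" if "0 < m" "balance c x m = 0" "0 < m'" "balance c x m' = 0" for m m'
    using balance_strict_decreasing[of x m m'] balance_strict_decreasing[of x m' m] gt that x
    by (cases m m' rule: linorder_cases) force+
  ultimately show ?thesis
    by blast
qed

section \<open>The zero curve and its continuity\<close>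

text \<open>The two constants are the one-sided limits of the curve at 0 and \<open>width\<close>,
  so that it is continuous on the closed interval.\<close>

definition zero_curve :: "real \<Rightarrow> real" where
  "zero_curve x =
     (if x \<le> 0 then 1 / cos (c / 2)
      else if x < width then (THE m. 0 < m \<and> balance c x m = 0)
      else width - 1)"

context
  fixes x :: real
  assumes x: "0 < x" "x < width"
begin

lemma zero_curve_pos: "0 < zero_curve x"
  and balance_zero_curve: "balance c x (zero_curve x) = 0"
  using theI'[OF ex1_balance_zero[OF x]] x by (simp_all add: zero_curve_def)

lemma zero_curve_gt: "\<bar>x - 1\<bar> < zero_curve x"
  using balance_pos[of "zero_curve x" x] zero_curve_pos balance_zero_curve x by force

text \<open>This turns comparison with the implicitly defined curve into a sign condition on
  \<open>balance\<close>, which is open in \<open>x\<close> for fixed \<open>m\<close>. The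
  continuity and limit proofs rest on it.\<close>

lemma balance_pos_iff:
  assumes "0 < m"
  shows "0 < balance c x m \<longleftrightarrow> m < zero_curve x"
    and "balance c x m < 0 \<longleftrightarrow> zero_curve x < m"
proof -
  have "0 < balance c x m" if "m < zero_curve x"
  proof (cases "m \<le> \<bar>x - 1\<bar>")
    case False
    thus ?thesis
      using balance_strict_decreasing[of x m "zero_curve x"] balance_zero_curve assms that x by simp
  qed (use balance_pos assms x in auto)
  moreover have "balance c x m < 0" if "zero_curve x < m"
    using balance_strict_decreasing[of x "zero_curve x" m] balance_zero_curve
      zero_curve_gt zero_curve_pos that x by simp
  ultimately show "0 < balance c x m \<longleftrightarrow> m < zero_curve x"
    and "balance c x m < 0 \<longleftrightarrow> zero_curve x < m"
    using balance_zero_curve by (cases m "zero_curve x" rule: linorder_cases; force)+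
qed

end

lemma isCont_balance: "0 < m \<Longrightarrow> isCont (\<lambda>x. balance c x m) x"
  by (rule DERIV_isCont[OF DERIV_balance_left])

lemma isCont_zero_curve:
  assumes x: "0 < x" "x < width"
  shows "isCont zero_curve x"
  unfolding isCont_def
proof (rule order_tendstoI)
  have inside: "eventually (\<lambda>y. y \<in> {0<..<width}) (at x)"
    using x by (intro eventually_at_in_open') auto
  have lim: "((\<lambda>y. balance c y m) \<longlongrightarrow> balance c x m) (at x)" if "0 < m" for m
    using isCont_balance[OF that] by (simp add: isCont_def)
  show "eventually (\<lambda>y. l < zero_curve y) (at x)" if l: "l < zero_curve x" for l
  proof (cases "0 < l")
    case True
    hence "0 < balance c x l"
      using balance_pos_iff[OF x] l by simp
    with lim[OF True] have "eventually (\<lambda>y. 0 < balance c y l) (at x)"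
      by (rule order_tendstoD)
    with inside show ?thesis
      by eventually_elim (use balance_pos_iff True in auto)
  next
    case False
    from inside show ?thesis
      by eventually_elim (use zero_curve_pos False in force)
  qed
  show "eventually (\<lambda>y. zero_curve y < u) (at x)" if u: "zero_curve x < u" for u
  proof -
    have "0 < u"
      using zero_curve_pos[OF x] u by linarith
    hence "balance c x u < 0"
      using balance_pos_iff[OF x] u by simp
    with lim[OF \<open>0 < u\<close>] have "eventually (\<lambda>y. balance c y u < 0) (at x)"
      by (rule order_tendstoD)
    with inside show ?thesis
      by eventually_elim (use balance_pos_iff \<open>0 < u\<close> in auto)
  qed
qed

section \<open>Limits at the ends of the interval\<close>

lemma cos_half_c: "0 < cos (c / 2)"
  using c_pos c_less by (intro cos_gt_zero_pi) auto

lemma cos_half_c_less_1: "cos (c / 2) < 1"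
  using cos_monotone_0_pi[of 0 "c / 2"] c_pos c_less by simp

text \<open>Every \<open>\<mu>\<close> is a zero at \<open>x = 0\<close>, so near \<open>0\<close> the sign of \<^const>\<open>balance\<close> is that of its
  \<open>x\<close>-derivative at \<open>0\<close>, which changes sign exactly at \<open>\<mu> = 1 / cos (c / 2)\<close>.\<close>

lemma DERIV_balance_at_0:
  assumes "0 < m"
  shows "((\<lambda>x. balance c x m) has_real_derivative 2 * clamped_arcsin (1 / m) - (pi - c)) (at 0)"
  using DERIV_balance_left[OF assms, of 0] clamped_arcsin_minus[of "1 / m"] by simp

lemma clamped_arcsin_cos_half_c: "clamped_arcsin (cos (c / 2)) = pi / 2 - c / 2"
  using clamped_arcsin_sin[of "pi / 2 - c / 2"] c_pos c_less by (simp add: cos_sin_eq abs_le_iff)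

lemma tendsto_zero_curve_0: "(zero_curve \<longlongrightarrow> 1 / cos (c / 2)) (at_right 0)"
proof (rule order_tendstoI)
  have inside: "eventually (\<lambda>y. y \<in> {0<..<width}) (at_right 0)"
    using width_gt_1 by (intro eventually_at_right_real) auto
  show "eventually (\<lambda>y. l < zero_curve y) (at_right 0)" if l: "l < 1 / cos (c / 2)" for l
  proof (cases "0 < l")
    case True
    have "clamped_arcsin (cos (c / 2)) < clamped_arcsin (1 / l)"
      using True l cos_half_c cos_half_c_less_1
      by (intro clamped_arcsin_less) (auto simp: field_simps intro: order.strict_trans[of _ 0])
    hence "0 < 2 * clamped_arcsin (1 / l) - (pi - c)"
      by (simp add: clamped_arcsin_cos_half_c)
    from DERIV_pos_inc_right[OF DERIV_balance_at_0[OF True] this]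
    obtain d where d: "d > 0" "\<And>h. 0 < h \<Longrightarrow> h < d \<Longrightarrow> 0 < balance c h l"
      by (auto simp: balance_0)
    have "eventually (\<lambda>y. y \<in> {0<..<d}) (at_right 0)"
      using d by (intro eventually_at_right_real) auto
    with inside show ?thesis
      by eventually_elim (use d(2) True in \<open>simp flip: balance_pos_iff\<close>)
  next
    case False
    from inside show ?thesis
      by eventually_elim (use zero_curve_pos False in force)
  qed
  show "eventually (\<lambda>y. zero_curve y < u) (at_right 0)" if u: "1 / cos (c / 2) < u" for u
  proof -
    have "0 < u"
      using cos_half_c u by (meson less_trans zero_less_divide_1_iff)
    have "clamped_arcsin (1 / u) < clamped_arcsin (cos (c / 2))"
      using \<open>0 < u\<close> u cos_half_c cos_half_c_less_1
      by (intro clamped_arcsin_less)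
        (auto simp: field_simps intro: order.strict_trans[of _ 0] order.strict_trans2[of _ "u * cos (c / 2)"])
    hence "2 * clamped_arcsin (1 / u) - (pi - c) < 0"
      by (simp add: clamped_arcsin_cos_half_c)
    from DERIV_neg_dec_right[OF DERIV_balance_at_0[OF \<open>0 < u\<close>] this]
    obtain d where d: "d > 0" "\<And>h. 0 < h \<Longrightarrow> h < d \<Longrightarrow> balance c h u < 0"
      by (auto simp: balance_0)
    have "eventually (\<lambda>y. y \<in> {0<..<d}) (at_right 0)"
      using d by (intro eventually_at_right_real) auto
    with inside show ?thesis
      by eventually_elim (use d(2) \<open>0 < u\<close> in \<open>simp flip: balance_pos_iff\<close>)
  qed
qed

text \<open>From below the curve is bounded by \<open>x - 1\<close>; from above,
  \<open>balance\<close> is negative at \<open>(width, u)\<close> for \<open>u > width - 1\<close>,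
  hence also nearby.\<close>

lemma tendsto_zero_curve_width: "(zero_curve \<longlongrightarrow> width - 1) (at_left width)"
proof (rule order_tendstoI)
  have inside: "eventually (\<lambda>y. y \<in> {0<..<width}) (at_left width)"
    using width_gt_1 by (intro eventually_at_left_real) auto
  show "eventually (\<lambda>y. l < zero_curve y) (at_left width)" if l: "l < width - 1" for l
  proof -
    have "eventually (\<lambda>y. y \<in> {l + 1<..<width}) (at_left width)"
      using l by (intro eventually_at_left_real) auto
    with inside show ?thesis
      by eventually_elim (use zero_curve_gt in force)
  qed
  show "eventually (\<lambda>y. zero_curve y < u) (at_left width)" if u: "width - 1 < u" for u
  proof -
    have "0 < u"
      using width_gt_1 u by linarith
    have "((\<lambda>y. balance c y u) \<longlongrightarrow> balance c width u) (at_left width)"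
      using isCont_balance[OF \<open>0 < u\<close>] by (intro tendsto_within_subset[OF isContD]) auto
    hence "eventually (\<lambda>y. balance c y u < 0) (at_left width)"
      using balance_width(2)[OF \<open>0 < u\<close> u] by (rule order_tendstoD)
    with inside show ?thesis
      by eventually_elim (use balance_pos_iff \<open>0 < u\<close> in auto)
  qed
qed

lemma zero_curve_0: "zero_curve 0 = 1 / cos (c / 2)"
  and zero_curve_width: "zero_curve width = width - 1"
  using width_gt_1 by (auto simp: zero_curve_def)

lemma continuous_on_zero_curve: "continuous_on {0..width} zero_curve"
  using width_gt_1 isCont_zero_curve tendsto_zero_curve_0 tendsto_zero_curve_width
  by (intro continuous_on_IccI) (auto simp: zero_curve_0 zero_curve_width isCont_def)

section \<open>Slope of the zero curve and its sign\<close>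

lemma DERIV_zero_curve:
  assumes x: "0 < x" "x < width"
  defines "P \<equiv> clamped_arcsin ((x + 1) / zero_curve x)"
    and "Q \<equiv> clamped_arcsin ((x - 1) / zero_curve x)"
  shows "(zero_curve has_real_derivative (P - Q - (pi - c)) / (cos Q - cos P)) (at x)"
    and "cos P < cos Q"
proof -
  show less: "cos P < cos Q"
    unfolding P_def Q_def using cos_clamped_arcsin_less zero_curve_gt x by blast
  have "(zero_curve has_real_derivative - (P - Q - (pi - c)) / (cos P - cos Q)) (at x)"
  proof (rule implicit_function_derivative)
    show "((\<lambda>(x, m). balance c x m) has_derivative
        (\<lambda>(h, k). (P - Q - (pi - c)) * h + (cos P - cos Q) * k)) (at (x, zero_curve x))"
      unfolding P_def Q_def by (intro has_derivative_balance zero_curve_pos x)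
    show "isCont zero_curve x"
      using x by (rule isCont_zero_curve)
    have "eventually (\<lambda>y. y \<in> {0<..<width}) (nhds x)"
      using x by (intro eventually_nhds_in_open) auto
    thus "eventually (\<lambda>y. (case (y, zero_curve y) of (x, m) \<Rightarrow> balance c x m) = 0) (nhds x)"
      by eventually_elim (use balance_zero_curve in auto)
  qed (use less in auto)
  moreover have "- (P - Q - (pi - c)) / (cos P - cos Q) = (P - Q - (pi - c)) / (cos Q - cos P)"
    using minus_divide_divide[of "P - Q - (pi - c)" "cos Q - cos P"] by simp
  ultimately show "(zero_curve has_real_derivative (P - Q - (pi - c)) / (cos Q - cos P)) (at x)"
    by simp
qed

text \<open>A horizontal tangent with \<open>P = pi / 2\<close> means \<open>Q = c - pi / 2\<close>.
  The zero equation then reduces to \<open>m * sin c = c\<close>, and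
  \<open>x - 1 = m * sin Q = - m * cos c\<close>.\<close>

definition peak :: real where
  "peak = 1 - c / sin c * cos c"

lemma sin_c_pos: "0 < sin c"
  using c_pos c_less by (simp add: sin_gt_zero)

text \<open>Both bounds are instances of \<open>mult_cos_less_sin\<close>, at \<open>c\<close> and
  at \<open>pi - c\<close>.\<close>

lemma peak_bounds: "0 < peak" "peak < width"
proof -
  show "0 < peak"
    using mult_cos_less_sin[OF c_pos c_less] sin_c_pos by (simp add: peak_def field_simps)
  have "(pi - c) * cos (pi - c) < sin (pi - c)"
    using c_pos c_less by (intro mult_cos_less_sin) auto
  hence "c * (- cos c * (pi - c)) < c * sin c"
    using c_pos by (intro mult_strict_left_mono) (simp_all add: mult.commute)
  hence "- (c / sin c * cos c) < c / (pi - c)"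
    using sin_c_pos c_less by (simp add: field_simps)
  moreover have "width = 1 + c / (pi - c)"
    using c_less by (simp add: width_def field_simps)
  ultimately show "peak < width"
    by (simp add: peak_def)
qed

text \<open>By convexity of \<^const>\<open>arcsin_primitive\<close>, the horizontal line through the peak is not
  crossed to the right of it; there the range of \<open>x - \<mu> cos t\<close> stays above \<open>-1\<close>.\<close>

lemma zero_curve_le_right_of_peak:
  assumes "peak \<le> x" "x < width"
  shows "zero_curve x \<le> x + 1"
proof -
  \<comment> \<open>The height of the curve at the peak, as confirmed by
    \<open>balance c peak m = 0\<close> below.\<close>
  define m where "m = c / sin c"
  have m: "0 < m"
    using c_pos sin_c_pos by (simp add: m_def)
  have "c * (1 + cos c) < 2 * sin c"
    using c_pos c_less by (rule mult_one_plus_cos_less_sin)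
  hence "m \<le> peak + 1"
    using sin_c_pos by (simp add: m_def peak_def field_simps)
  have "(peak - 1) / m = sin (c - pi / 2)"
    using c_pos sin_c_pos by (simp add: peak_def m_def sin_diff)
  moreover have "\<bar>c - pi / 2\<bar> \<le> pi / 2"
    using c_pos c_less by linarith
  ultimately have Q: "clamped_arcsin ((peak - 1) / m) = c - pi / 2"
    by (metis clamped_arcsin_sin)
  have P: "clamped_arcsin ((peak + 1) / m) = pi / 2"
    using m \<open>m \<le> peak + 1\<close> by (intro clamped_arcsin_ge_1) (simp add: field_simps)
  have "balance c peak m = (peak + 1) * (pi / 2) - ((peak - 1) * (c - pi / 2) + m * cos (c - pi / 2))
      - (pi - c) * peak"
    using balance_expand[of m c peak] m by (simp add: P Q)
  also have "m * cos (c - pi / 2) = c"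
    using sin_c_pos by (simp add: m_def cos_diff)
  finally have 0: "balance c peak m = 0"
    by (simp add: field_simps)
  \<comment> \<open>The upper term grows with slope at most \<open>pi / 2\<close>, the lower one
    with slope at least \<open>c - pi / 2\<close>. The difference \<open>pi - c\<close> is exactly
    the slope of the subtracted linear term.\<close>
  have "m * (arcsin_primitive ((x + 1) / m) - arcsin_primitive ((peak + 1) / m)) \<le>
      m * (clamped_arcsin ((x + 1) / m) * ((x + 1) / m - (peak + 1) / m))"
    using arcsin_primitive_subgradient[of "(x + 1) / m" "(peak + 1) / m"] m
    by (intro mult_left_mono) (auto simp: algebra_simps)
  also have "\<dots> = (x - peak) * clamped_arcsin ((x + 1) / m)"
    using m by (simp add: field_simps)
  also have "\<dots> \<le> (x - peak) * (pi / 2)"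
    using assms clamped_arcsin_bounds by (intro mult_left_mono) auto
  finally have 1: "m * (arcsin_primitive ((x + 1) / m) - arcsin_primitive ((peak + 1) / m))
      \<le> (x - peak) * (pi / 2)" .
  have "(x - peak) * (c - pi / 2) = m * ((c - pi / 2) * ((x - 1) / m - (peak - 1) / m))"
    using m by (simp add: field_simps)
  also have "\<dots> \<le> m * (arcsin_primitive ((x - 1) / m) - arcsin_primitive ((peak - 1) / m))"
    using arcsin_primitive_subgradient[of "(peak - 1) / m" "(x - 1) / m"] m
    by (intro mult_left_mono) (auto simp: Q)
  finally have 2: "(x - peak) * (c - pi / 2)
      \<le> m * (arcsin_primitive ((x - 1) / m) - arcsin_primitive ((peak - 1) / m))" .
  have "balance c x m \<le> balance c peak m"
  proof -
    have "(x - peak) * (pi / 2) - (x - peak) * (c - pi / 2) = (pi - c) * x - (pi - c) * peak"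
      by (simp add: field_simps)
    with 1 2 show ?thesis
      unfolding balance_def right_diff_distrib[of m] by linarith
  qed
  hence "\<not> m < zero_curve x"
    using balance_pos_iff(1)[of x m] assms peak_bounds m 0 by auto
  with \<open>m \<le> peak + 1\<close> assms show ?thesis
    by linarith
qed

text \<open>By the product formula the two cosines contribute at most
  \<open>(1 + cos d) / 2\<close>, whatever \<open>u\<close> is.\<close>

lemma sin_minus_mult_cos_cos_pos:
  assumes "0 < d" "d < pi"
  shows "0 < sin d - d * (cos u * cos (u - d))"
proof -
  have "cos u * cos (u - d) \<le> (1 + cos d) / 2"
    using cos_le_one[of "u + (u - d)"] cos_times_cos[of u "u - d"] by simp
  hence "d * (cos u * cos (u - d)) \<le> d * ((1 + cos d) / 2)"
    using assms by (intro mult_left_mono) auto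
  also have "\<dots> < sin d"
    using mult_one_plus_cos_less_sin[OF assms] by simp
  finally show ?thesis
    by simp
qed

text \<open>By homogeneity, \<open>x * (P - Q - (pi - c)) = m * (cos Q - cos P) - (P + Q)\<close> on the zero set.\<close>

lemma slope_pos_both_clamped:
  assumes x: "0 < x" "x < width" and "x + 1 < zero_curve x"
  defines "P \<equiv> clamped_arcsin ((x + 1) / zero_curve x)"
    and "Q \<equiv> clamped_arcsin ((x - 1) / zero_curve x)"
  shows "0 < P - Q - (pi - c)"
proof -
  define m where "m = zero_curve x"
  have m: "0 < m"
    using zero_curve_pos[OF x] by (simp add: m_def)
  have sinP: "m * sin P = x + 1" and sinQ: "m * sin Q = x - 1"
    using assms m by (simp_all add: sin_clamped_arcsin_eq flip: m_def)
  have PQ: "\<bar>Q\<bar> < P" "P \<le> pi / 2"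
    unfolding P_def Q_def using clamped_arcsin_abs_less zero_curve_gt x clamped_arcsin_bounds by auto
  \<comment> \<open>In half sum and half difference, \<open>m * (sin P - sin Q) = 2\<close> reads
    \<open>m * sin v * cos u = 1\<close>, and the wanted \<open>P + Q < m * (cos Q - cos P)\<close>
    becomes \<open>u * cos u < sin u\<close>.\<close>
  define u v where "u = (P + Q) / 2" and "v = (P - Q) / 2"
  have uv: "0 < u" "u < pi" "0 < v" "v < pi"
    using PQ pi_gt_zero by (auto simp: u_def v_def)
  have "sin P - sin Q = 2 * sin v * cos u" "cos Q - cos P = 2 * sin u * sin v"
    using sin_diff_sin[of P Q] cos_diff_cos[of Q P] by (simp_all add: u_def v_def add.commute)
  moreover have "m * (sin P - sin Q) = 2"
    using sinP sinQ by (simp add: algebra_simps)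
  ultimately have 1: "m * sin v * cos u = 1" and 2: "m * (cos Q - cos P) = 2 * (m * sin v * sin u)"
    by (simp_all add: algebra_simps)
  have "m * sin v * (u * cos u) < m * sin v * sin u"
    using uv m by (intro mult_strict_left_mono mult_cos_less_sin) (auto intro!: sin_gt_zero mult_pos_pos)
  moreover have "m * sin v * (u * cos u) = u"
    using 1 by (simp add: algebra_simps)
  moreover have "P + Q = 2 * u"
    by (simp add: u_def)
  ultimately have "P + Q < m * (cos Q - cos P)"
    unfolding 2 by linarith
  moreover have "balance c x m = 0"
    using balance_zero_curve[OF x] by (simp add: m_def)
  hence "(x + 1) * P + m * cos P - ((x - 1) * Q + m * cos Q) - (pi - c) * x = 0"
    using balance_expand[of m c x] m unfolding P_def Q_def by (simp flip: m_def)
  ultimately have "0 < x * (P - Q - (pi - c))"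
    by (simp add: algebra_simps)
  with x show ?thesis
    by (simp add: zero_less_mult_iff)
qed

text \<open>Here \<open>P = pi / 2\<close>, and with \<open>s = Q + pi / 2\<close> the slope
  numerator is \<open>d = c - s\<close>. Eliminating the curve equation expresses
  \<open>(peak - x) * sin c\<close> as a positive multiple of
  \<open>sin d - d * (cos c * cos s)\<close>, which has the sign of \<open>d\<close>.\<close>

lemma slope_sgn_one_clamped:
  assumes x: "0 < x" "x < width" and "zero_curve x \<le> x + 1"
  defines "P \<equiv> clamped_arcsin ((x + 1) / zero_curve x)"
    and "Q \<equiv> clamped_arcsin ((x - 1) / zero_curve x)"
  shows "sgn (P - Q - (pi - c)) = sgn (peak - x)"
proof -
  define m where "m = zero_curve x"
  have m: "0 < m"
    using zero_curve_pos[OF x] by (simp add: m_def)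
  have P: "P = pi / 2"
    unfolding P_def using assms m by (intro clamped_arcsin_ge_1) (simp add: m_def)
  have sinQ: "m * sin Q = x - 1"
    using zero_curve_gt[OF x] m
    by (simp add: Q_def sin_clamped_arcsin_eq flip: m_def)
  have PQ: "\<bar>Q\<bar> < pi / 2"
    using clamped_arcsin_abs_less[OF x(1) zero_curve_gt[OF x]] unfolding P[symmetric] P_def Q_def .
  define s where "s = Q + pi / 2"
  have s: "0 < s" "s < pi" "sin s = cos Q" "cos s = - sin Q"
    using PQ by (auto simp: s_def sin_add cos_add)
  define d where "d = c - s"
  have d: "\<bar>d\<bar> < pi"
    using s c_pos c_less by (auto simp: d_def)
  have "balance c x m = 0"
    using balance_zero_curve[OF x] by (simp add: m_def)
  hence "(x + 1) * P + m * cos P - ((x - 1) * Q + m * cos Q) - (pi - c) * x = 0"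
    using balance_expand[of m c x] m unfolding P_def Q_def by (simp flip: m_def)
  moreover have x_eq: "x = 1 - m * cos s"
    using sinQ s by simp
  moreover have "Q = s - pi / 2" "cos P = 0" "cos Q = sin s"
    by (simp_all add: s_def P s(3)[unfolded s_def])
  ultimately have "(1 - m * cos s + 1) * (pi / 2) - ((1 - m * cos s - 1) * (s - pi / 2) + m * sin s)
      - (pi - c) * (1 - m * cos s) = 0"
    by (simp add: P)
  hence c_eq: "c = m * (sin s + d * cos s)"
    by (simp add: d_def field_simps)
  have "(peak - x) * sin c = m * cos s * sin c - c * cos c"
    using sin_c_pos by (simp add: peak_def x_eq field_simps)
  also have "\<dots> = m * (sin d - d * (cos c * cos s))"
    \<comment> \<open>Only the factor \<open>c\<close> is replaced, not the \<open>c\<close> inside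
      sine and cosine; the rest is the subtraction formula for \<open>sin (c - s)\<close>.\<close>
    by (subst (2) c_eq) (simp add: d_def sin_diff algebra_simps)
  finally have *: "(peak - x) * sin c = m * (sin d - d * (cos c * cos s))" .
  have "sgn (sin d - d * (cos c * cos s)) = sgn d"
  proof (cases d "0 :: real" rule: linorder_cases)
    case greater
    have "0 < sin d - d * (cos c * cos (c - d))"
      using greater d by (intro sin_minus_mult_cos_cos_pos) auto
    with greater show ?thesis
      by (simp add: d_def)
  next
    case less
    \<comment> \<open>The same inequality with \<open>c\<close> and \<open>s\<close> exchanged,
      since \<open>- d = s - c\<close>.\<close>
    have "0 < sin (- d) - (- d) * (cos s * cos (s - (- d)))"
      using less d by (intro sin_minus_mult_cos_cos_pos) auto
    moreover have "s - (- d) = c"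
      by (simp add: d_def)
    ultimately show ?thesis
      using less by (simp add: mult.commute)
  qed auto
  hence "sgn ((peak - x) * sin c) = sgn d"
    using m by (simp add: * sgn_mult)
  moreover have "P - Q - (pi - c) = d"
    by (simp add: P d_def s_def)
  ultimately show ?thesis
    using sin_c_pos by (simp add: sgn_mult)
qed

text \<open>Where the curve lies above \<open>x + 1\<close>,
  \<open>zero_curve_le_right_of_peak\<close> forces \<open>x < peak\<close>, so both signs are
  positive there.\<close>

lemma sgn_deriv_zero_curve:
  assumes x: "0 < x" "x < width"
  shows "sgn (deriv zero_curve x) = sgn (peak - x)"
proof -
  define P Q where "P = clamped_arcsin ((x + 1) / zero_curve x)"
    and "Q = clamped_arcsin ((x - 1) / zero_curve x)"
  have "deriv zero_curve x = (P - Q - (pi - c)) / (cos Q - cos P)" and "cos P < cos Q"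
    using DERIV_zero_curve[OF x] by (simp_all add: DERIV_imp_deriv P_def Q_def)
  hence "sgn (deriv zero_curve x) = sgn (P - Q - (pi - c))"
    by (simp add: sgn_divide)
  also have "\<dots> = sgn (peak - x)"
  proof (cases "zero_curve x \<le> x + 1")
    case True
    thus ?thesis
      unfolding P_def Q_def using x by (intro slope_sgn_one_clamped)
  next
    case False
    hence "x < peak"
      using zero_curve_le_right_of_peak[of x] x by linarith
    with slope_pos_both_clamped[OF x] False show ?thesis
      by (simp add: P_def Q_def)
  qed
  finally show ?thesis .
qed

end

section \<open>Description of the zero set\<close>

text \<open>The reflections make membership depend only on \<open>\<bar>x\<bar>\<close> and
  \<open>\<bar>\<mu>\<bar>\<close>; positivity of \<open>\<phi>\<close> merges the two branches into
  \<open>\<bar>\<mu>\<bar> = \<phi> \<bar>x\<bar>\<close>.\<close>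

lemma mem_Z1_symmetric_iff:
  assumes "\<And>x. 0 < x \<Longrightarrow> x < 1 - b / a \<Longrightarrow> 0 < \<phi> x" and "a * b < 0"
  shows "(x, \<mu>) \<in> {(0, \<mu>) | \<mu>. True} \<union> Z1 a b \<phi> \<union> S1 ` Z1 a b \<phi> \<union> S2 ` Z1 a b \<phi> \<union> S2 ` (S1 ` Z1 a b \<phi>)
    \<longleftrightarrow> x = 0 \<or> \<bar>x\<bar> = 1 - b / a \<and> \<bar>\<mu>\<bar> \<le> - b / a \<or> 0 < \<bar>x\<bar> \<and> \<bar>x\<bar> < 1 - b / a \<and> \<bar>\<mu>\<bar> = \<phi> \<bar>x\<bar>"
proof -
  have ba: "b / a < 0"
    using assms(2) by (simp add: divide_less_0_iff mult_less_0_iff) blast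
  have Z1: "(x, \<mu>) \<in> Z1 a b \<phi> \<longleftrightarrow> x = 1 - b / a \<and> 0 \<le> \<mu> \<and> \<mu> \<le> - b / a \<or> \<mu> = \<phi> x \<and> 0 < x \<and> x < 1 - b / a"
    for x \<mu>
    by (auto simp: Z1_def)
  have S1: "(x, \<mu>) \<in> S1 ` A \<longleftrightarrow> (- x, \<mu>) \<in> A" for A x \<mu>
    by (force simp: S1_def image_iff)
  have S2: "(x, \<mu>) \<in> S2 ` A \<longleftrightarrow> (x, - \<mu>) \<in> A" for A x \<mu>
    by (force simp: S2_def image_iff)
  have pos: "0 < \<phi> \<bar>x\<bar>" if "0 < \<bar>x\<bar>" "\<bar>x\<bar> < 1 - b / a"
    using assms that by blast
  show ?thesis
    unfolding Un_iff Z1 S1 S2 using ba pos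
    by (cases "x \<ge> 0"; cases "\<mu> \<ge> 0") auto
qed

context clamped_balance
begin

context
  fixes a b :: real
  assumes ab: "a * b < 0" and c_eq: "(b - a) * c = pi * b"
begin

lemma width_eq: "width = 1 - b / a"
proof -
  have "a \<noteq> 0"
    using ab by auto
  have "(b - a) * (pi - c) = - pi * a"
    using c_eq by (simp add: algebra_simps)
  hence "(pi - c) * (1 - b / a) = pi"
    using \<open>a \<noteq> 0\<close> by (simp add: field_simps)
  thus ?thesis
    using width_mult c_less by (metis diff_gt_0_iff_gt less_irrefl mult_left_cancel)
qed

text \<open>This settles the line \<open>\<mu> = 0\<close>, which \<open>M_eq_balance\<close>
  excludes: there \<open>M\<close> is \<open>2 * pi\<close> times \<open>pwl\<close>.\<close>

lemma pwl_eq_0_iff: "pwl a b x = 0 \<longleftrightarrow> x = 0 \<or> \<bar>x\<bar> = width"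
proof -
  have nz: "a \<noteq> 0" "b \<noteq> 0"
    using ab by auto
  consider "x \<le> -1" | "-1 < x" "x < 1" | "x \<ge> 1"
    by linarith
  thus ?thesis
  proof cases
    case 1
    hence "pwl a b x = a * (x + width)"
      using nz by (simp add: pwl_def width_eq field_simps)
    with 1 nz show ?thesis
      by auto
  next
    case 2
    with nz width_gt_1 show ?thesis
      by (auto simp: pwl_def)
  next
    case 3
    hence "pwl a b x = a * (x - width)"
      using nz by (simp add: pwl_def width_eq field_simps)
    with 3 nz width_gt_1 show ?thesis
      by auto
  qed
qed

text \<open>For nonzero \<open>\<mu>\<close>, oddness of \<open>balance\<close> in \<open>x\<close>
  reduces to \<open>\<bar>x\<bar>\<close>, which is then compared with \<open>width\<close>.\<close>

lemma M_eq_0_iff: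
  "M a b (x, \<mu>) = 0 \<longleftrightarrow>
    x = 0 \<or> \<bar>x\<bar> = width \<and> \<bar>\<mu>\<bar> \<le> width - 1 \<or> 0 < \<bar>x\<bar> \<and> \<bar>x\<bar> < width \<and> \<bar>\<mu>\<bar> = zero_curve \<bar>x\<bar>"
proof (cases "\<mu> = 0")
  case True
  thus ?thesis
    using width_gt_1 zero_curve_pos[of "\<bar>x\<bar>"] by (auto simp: M_zero pwl_eq_0_iff)
next
  case False
  define m where "m = \<bar>\<mu>\<bar>"
  have m: "0 < m"
    using False by (simp add: m_def)
  have "b \<noteq> a"
    using ab by (auto simp: mult_less_0_iff)
  hence "M a b (x, \<mu>) = 0 \<longleftrightarrow> balance c x m = 0"
    using M_eq_balance[OF False c_eq] by (simp add: m_def)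
  also have "\<dots> \<longleftrightarrow> balance c \<bar>x\<bar> m = 0"
    by (auto simp: abs_if balance_minus)
  also have "\<dots> \<longleftrightarrow> x = 0 \<or> \<bar>x\<bar> = width \<and> m \<le> width - 1 \<or> 0 < \<bar>x\<bar> \<and> \<bar>x\<bar> < width \<and> m = zero_curve \<bar>x\<bar>"
  proof -
    have "balance c \<bar>x\<bar> m = 0 \<longleftrightarrow> m = zero_curve \<bar>x\<bar>" if "0 < \<bar>x\<bar>" "\<bar>x\<bar> < width"
      using balance_pos_iff[OF that m] balance_zero_curve[OF that] by force
    moreover have "balance c width m = 0 \<longleftrightarrow> m \<le> width - 1"
      using balance_width[OF m] by force
    moreover have "balance c \<bar>x\<bar> m < 0" if "width < \<bar>x\<bar>"
      using balance_neg_beyond_width[OF m that] .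
    ultimately show ?thesis
      using width_gt_1 by (cases "\<bar>x\<bar>" width rule: linorder_cases) (auto simp: balance_0)
  qed
  finally show ?thesis
    by (simp add: m_def)
qed

lemma describes_zeros_iff:
  "describes_zeros a b \<phi> \<longleftrightarrow>
     \<phi> \<in> {0..width} \<rightarrow> {0<..} \<and> (\<forall>x\<in>{0<..<width}. \<phi> x = zero_curve x)"
proof (cases "\<phi> \<in> {0..width} \<rightarrow> {0<..}")
  case True
  have "M a b -` {0} = {(0, \<mu>) | \<mu>. True} \<union> Z1 a b \<phi> \<union> S1 ` Z1 a b \<phi> \<union> S2 ` Z1 a b \<phi> \<union> S2 ` (S1 ` Z1 a b \<phi>)
      \<longleftrightarrow> (\<forall>x \<mu>. M a b (x, \<mu>) = 0 \<longleftrightarrow> x = 0 \<or> \<bar>x\<bar> = width \<and> \<bar>\<mu>\<bar> \<le> width - 1 \<or>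
        0 < \<bar>x\<bar> \<and> \<bar>x\<bar> < width \<and> \<bar>\<mu>\<bar> = \<phi> \<bar>x\<bar>)"
    unfolding set_eq_iff split_paired_All
    using True by (subst mem_Z1_symmetric_iff[OF _ ab]) (auto simp: width_eq)
  also have "\<dots> \<longleftrightarrow> (\<forall>x\<in>{0<..<width}. \<phi> x = zero_curve x)"
  proof
    assume *: "\<forall>x \<mu>. M a b (x, \<mu>) = 0 \<longleftrightarrow> x = 0 \<or> \<bar>x\<bar> = width \<and> \<bar>\<mu>\<bar> \<le> width - 1 \<or>
        0 < \<bar>x\<bar> \<and> \<bar>x\<bar> < width \<and> \<bar>\<mu>\<bar> = \<phi> \<bar>x\<bar>"
    show "\<forall>x\<in>{0<..<width}. \<phi> x = zero_curve x"
    proof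
      fix x assume x: "x \<in> {0<..<width}"
      \<comment> \<open>Testing the description at this one point already forces
        \<open>\<phi> x = zero_curve x\<close>.\<close>
      hence "M a b (x, zero_curve x) = 0"
        using zero_curve_pos[of x] by (simp add: M_eq_0_iff)
      with x * zero_curve_pos[of x] show "\<phi> x = zero_curve x"
        by force
    qed
  qed (auto simp: M_eq_0_iff)
  finally show ?thesis
    by (simp add: describes_zeros_def width_eq)
qed (auto simp: describes_zeros_def width_eq)

end

end

section \<open>Uniqueness up to the endpoints and conclusion\<close>

text \<open>The zero set fixes \<open>\<phi>\<close> only on the open interval; density of that
  interval and continuity carry the equality to the endpoints.\<close>

lemma eq_on_closed_interval:
  fixes f g :: "real \<Rightarrow> real"
  assumes "continuous_on {u..v} f" "continuous_on {u..v} g" "u < v"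
    and "\<And>x. x \<in> {u<..<v} \<Longrightarrow> f x = g x" and "x \<in> {u..v}"
  shows "f x = g x"
proof -
  have cl: "closure {u<..<v} = {u..v}"
    using assms(3) by simp
  have "f x - g x = 0"
    by (rule continuous_constant_on_closure[of "{u<..<v}" "\<lambda>x. f x - g x"])
      (use assms in \<open>auto simp: cl intro!: continuous_intros\<close>)
  thus ?thesis
    by simp
qed

theorem theorem6p8:
  fixes a b c \<mu>1 \<mu>2 :: real
  assumes "a * b < 0"
    and "c = pi * b / (b - a)"
    and "\<mu>1 = c / sin c"
    and "\<mu>2 = 1 / cos (c / 2)"
  shows "\<exists>\<phi>. describes_zeros a b \<phi> \<and>
    (\<forall>\<psi>. describes_zeros a b \<psi> \<longrightarrow> (\<forall>x\<in>{0<..<1 - b / a}. \<psi> x = \<phi> x)) \<and>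
    (\<forall>\<psi>. describes_zeros a b \<psi> \<and> continuous_on {0..1 - b / a} \<psi> \<longrightarrow>
       (\<forall>x\<in>{0..1 - b / a}. \<psi> x = \<phi> x)) \<and>
    (\<forall>x\<in>{0<..<1 - b / a}. \<phi> differentiable (at x)) \<and>
    (\<exists>x1. x1 \<in> {0<..<1 - b / a} \<and> deriv \<phi> x1 = 0 \<and>
       (\<forall>x\<in>{0<..<1 - b / a}. deriv \<phi> x = 0 \<longrightarrow> x = x1) \<and>
       (\<forall>x\<in>{0<..<x1}. deriv \<phi> x > 0) \<and>
       (\<forall>x\<in>{x1<..<1 - b / a}. deriv \<phi> x < 0) \<and>
       x1 = 1 - \<mu>1 * cos c) \<and>
    continuous_on {0..1 - b / a} \<phi> \<and>
    \<phi> (1 - b / a) = - b / a \<and>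
    \<phi> 0 = \<mu>2"
proof -
  have "b \<noteq> a"
    using assms(1) by (auto simp: mult_less_0_iff)
  hence c_eq: "(b - a) * c = pi * b"
    by (simp add: assms(2))
  have "0 < c \<and> c < pi"
    using assms(1) unfolding assms(2) by (auto simp: mult_less_0_iff field_simps)
  then interpret clamped_balance c
    by unfold_locales auto
  note describes = describes_zeros_iff[OF assms(1) c_eq]
  have width: "1 - b / a = width"
    by (rule width_eq[OF assms(1) c_eq, symmetric])
  have sgn: "sgn (deriv zero_curve x) = sgn (peak - x)" if "x \<in> {0<..<width}" for x
    using sgn_deriv_zero_curve that by simp
  have "zero_curve x > 0" if "x \<in> {0..width}" for x
    using that zero_curve_pos[of x] zero_curve_0 zero_curve_width width_gt_1 cos_half_c
    by (cases "x = 0"; cases "x = width") auto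
  hence 1: "describes_zeros a b zero_curve"
    by (simp add: describes)
  have 2: "\<forall>\<psi>. describes_zeros a b \<psi> \<longrightarrow> (\<forall>x\<in>{0<..<width}. \<psi> x = zero_curve x)"
    by (simp add: describes)
  have 3: "\<forall>\<psi>. describes_zeros a b \<psi> \<and> continuous_on {0..width} \<psi> \<longrightarrow>
      (\<forall>x\<in>{0..width}. \<psi> x = zero_curve x)"
    using eq_on_closed_interval[OF _ continuous_on_zero_curve] width_gt_1 by (auto simp: describes)
  have 4: "\<forall>x\<in>{0<..<width}. zero_curve differentiable (at x)"
  proof
    fix x assume "x \<in> {0<..<width}"
    hence "0 < x" "x < width"
      by auto
    from DERIV_zero_curve(1)[OF this] show "zero_curve differentiable (at x)"
      unfolding real_differentiable_def by blast
  qed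
  \<comment> \<open>Every claim on the derivative is read off from the sign identity
    \<open>sgn\<close>.\<close>
  have 5: "peak \<in> {0<..<width} \<and> deriv zero_curve peak = 0 \<and>
       (\<forall>x\<in>{0<..<width}. deriv zero_curve x = 0 \<longrightarrow> x = peak) \<and>
       (\<forall>x\<in>{0<..<peak}. deriv zero_curve x > 0) \<and>
       (\<forall>x\<in>{peak<..<width}. deriv zero_curve x < 0) \<and>
       peak = 1 - \<mu>1 * cos c"
  proof (intro conjI ballI impI)
    show peak: "peak \<in> {0<..<width}"
      using peak_bounds by simp
    show "deriv zero_curve peak = 0"
      using sgn[OF peak] by (simp add: sgn_0_0)
    show "x = peak" if "x \<in> {0<..<width}" "deriv zero_curve x = 0" for x
      using sgn[OF that(1)] that(2) by (simp add: sgn_0_0)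
    show "deriv zero_curve x > 0" if "x \<in> {0<..<peak}" for x
      using sgn[of x] that peak by (simp add: sgn_1_pos)
    show "deriv zero_curve x < 0" if "x \<in> {peak<..<width}" for x
      using sgn[of x] that peak by (simp add: sgn_1_neg)
    show "peak = 1 - \<mu>1 * cos c"
      by (simp add: peak_def assms(3))
  qed
  have 6: "zero_curve width = - b / a" "zero_curve 0 = \<mu>2"
    using zero_curve_width zero_curve_0 assms(4) width by auto
  show ?thesis
    unfolding width
  proof (intro exI[of _ zero_curve] conjI)
    show "\<exists>x1. x1 \<in> {0<..<width} \<and> deriv zero_curve x1 = 0 \<and>
       (\<forall>x\<in>{0<..<width}. deriv zero_curve x = 0 \<longrightarrow> x = x1) \<and>
       (\<forall>x\<in>{0<..<x1}. deriv zero_curve x > 0) \<and>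
       (\<forall>x\<in>{x1<..<width}. deriv zero_curve x < 0) \<and>
       x1 = 1 - \<mu>1 * cos c"
      using 5 by (rule exI)
  qed (fact 1 2 3 4 6 continuous_on_zero_curve)+
qed

end
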